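(* Let $K$ be a field of characteristic $0$. Let $f\in K[x]$ with $\deg f\geqslant 2$, and let $\delta_f$ be the $K$-derivation on $K[x,y]$ defined by $\delta_f(x)=y$ and $\delta_f(y)=f$. Then for every $K$-derivation $\gamma$ on $K[x,y]$ that commutes with $\delta_f$ there exists $q\in K[H]$ such that $\gamma=q\cdot\delta_f$, where $H=y^2-2\int f\,dx$ and $\int f\,dx\in K[x]$ denotes the antiderivative of $f$ with respect to $x$ whose constant term is $0$.
   Context: A $K$-derivation on $K[x,y]$ is a map $d\colon K[x,y]\to K[x,y]$ that is additive, vanishes on $K$, and satisfies $d(ab)=d(a)b+a\,d(b)$. Two derivations $\gamma,\delta$ commute if $\gamma(\delta(a))=\delta(\gamma(a))$ for all $a\in K[x,y]$. $K[H]$ is the $K$-subalgebra of $K[x,y]$ generated by $H$, and $q\cdot\delta_f$ is the derivation $a\mapsto q\,\delta_f(a)$. *)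

theory Defs
  imports "HOL-Computational_Algebra.Polynomial"
begin

text \<open>
  The ring \<open>K[x,y]\<close> is modelled as \<open>K[x][y]\<close>, i.e. the type \<open>'a poly poly\<close>: the outer
  indeterminate is \<open>y\<close>, the inner one is \<open>x\<close>. A polynomial \<open>g \<in> K[x]\<close> is embedded as
  \<open>[:g:]\<close> and a scalar \<open>c \<in> K\<close> as \<open>[:[:c:]:]\<close>.
\<close>

definition varX :: "'a::comm_ring_1 poly poly"
  where "varX = [:[:0, 1:]:]"

definition varY :: "'a::comm_ring_1 poly poly"
  where "varY = [:0, 1:]"

definition K_derivation :: "('a::comm_ring_1 poly poly \<Rightarrow> 'a poly poly) \<Rightarrow> bool"
  where "K_derivation d \<longleftrightarrow>
    (\<forall>a b. d (a + b) = d a + d b) \<and>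
    (\<forall>c. d [:[:c:]:] = 0) \<and>
    (\<forall>a b. d (a * b) = d a * b + a * d b)"

definition K_subalgebra :: "'a::comm_ring_1 poly poly set \<Rightarrow> bool"
  where "K_subalgebra S \<longleftrightarrow>
    (\<forall>c. [:[:c:]:] \<in> S) \<and>
    (\<forall>a\<in>S. \<forall>b\<in>S. a + b \<in> S) \<and>
    (\<forall>a\<in>S. \<forall>b\<in>S. a * b \<in> S)"

definition K_adjoin :: "'a::comm_ring_1 poly poly \<Rightarrow> 'a poly poly set"
  where "K_adjoin h = K_subalgebra hull {h}"

lemma K_subalgebra_K_adjoin: "K_subalgebra (K_adjoin h)"
  unfolding K_adjoin_def by (rule hull_in) (auto simp: K_subalgebra_def)

definition antideriv :: "'a::field_char_0 poly \<Rightarrow> 'a poly"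
  where "antideriv f = (\<Sum>i\<le>degree f. monom (coeff f i / of_nat (Suc i)) (Suc i))"

lemma coeff_antideriv:
  "coeff (antideriv f) n = (case n of 0 \<Rightarrow> 0 | Suc m \<Rightarrow> coeff f m / of_nat (Suc m))"
  by (auto simp: antideriv_def coeff_sum coeff_eq_0 if_distrib split: nat.split cong: if_cong)

lemma pderiv_antideriv: "pderiv (antideriv f) = f"
  by (rule poly_eqI) (simp add: coeff_pderiv coeff_antideriv del: of_nat_Suc)

lemma antideriv_unique:
  assumes "pderiv F = f" "coeff F 0 = 0"
  shows "F = antideriv f"
proof (rule poly_eqI)
  fix n show "coeff F n = coeff (antideriv f) n"
    using assms
    by (cases n) (auto simp: coeff_antideriv coeff_pderiv simp del: of_nat_Suc)
qed

definition H_poly :: "'a::field_char_0 poly \<Rightarrow> 'a poly poly"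
  where "H_poly f = varY\<^sup>2 - 2 * [:antideriv f:]"

text \<open>A \<open>K\<close>-derivation exists and is unique for any prescribed images of \<open>x\<close> and \<open>y\<close>.\<close>

lemma map_poly_pderiv_add:
  fixes p q :: "'a::idom poly poly"
  shows "map_poly pderiv (p + q) = map_poly pderiv p + map_poly pderiv q"
  by (rule poly_eqI) (simp add: coeff_map_poly pderiv_add)

lemma map_poly_pderiv_mult:
  fixes p q :: "'a::idom poly poly"
  shows "map_poly pderiv (p * q) = map_poly pderiv p * q + p * map_poly pderiv q"
proof (rule poly_eqI)
  fix n
  have "pderiv (coeff p i * coeff q (n - i))
      = pderiv (coeff p i) * coeff q (n - i) + coeff p i * pderiv (coeff q (n - i))" for i
    by (simp add: pderiv_mult)
  then show "coeff (map_poly pderiv (p * q)) n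
      = coeff (map_poly pderiv p * q + p * map_poly pderiv q) n"
    by (simp add: coeff_map_poly coeff_mult higher_pderiv_sum[of 1, simplified] sum.distrib)
qed

lemma K_derivation_ex1:
  fixes u v :: "'a::idom poly poly"
  shows "\<exists>!d. K_derivation d \<and> d varX = u \<and> d varY = v"
proof (rule ex_ex1I)
  let ?d = "\<lambda>p. u * map_poly pderiv p + v * pderiv p"
  have "K_derivation ?d"
    unfolding K_derivation_def
    by (simp add: map_poly_pderiv_add map_poly_pderiv_mult pderiv_add pderiv_mult
        map_poly_pCons pderiv_pCons algebra_simps)
  moreover have "?d varX = u" "?d varY = v"
    by (simp_all add: varX_def varY_def map_poly_pCons pderiv_pCons map_poly_1 flip: one_pCons)
  ultimately show "\<exists>d. K_derivation d \<and> d varX = u \<and> d varY = v" by blast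
next
  fix d e
  assume d: "K_derivation d \<and> d varX = u \<and> d varY = v"
    and e: "K_derivation e \<and> e varX = u \<and> e varY = v"
  have inner: "d [:g:] = e [:g:]" for g
  proof (induction g)
    case 0
    show ?case using d e unfolding K_derivation_def by (metis pCons_0_0)
  next
    case (pCons a p)
    have "[:pCons a p:] = [:[:a:]:] + varX * [:p:]" by (simp add: varX_def)
    then show ?case using d e pCons unfolding K_derivation_def by (simp del: mult_pCons_right)
  qed
  have "d p = e p" for p
  proof (induction p)
    case 0
    show ?case using inner[of 0] by simp
  next
    case (pCons a p)
    have "pCons a p = [:a:] + varY * p" by (simp add: varY_def)
    then show ?case using d e pCons inner[of a] unfolding K_derivation_def by simp
  qed
  then show "d = e" by blast
qed

end

theory Submission
  imports Defs
begin

text \<open>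
  Put \<open>a = \<gamma>(x)\<close>. Commutation gives \<open>\<gamma>(y) = \<delta>(a)\<close> and \<open>\<delta>\<^sup>2(a) = f' a\<close>.
  Since \<open>y\<^sup>2 = H + 2F\<close> with \<open>F = \<integral>f\<close>, the ring \<open>K[x,y]\<close> is free over \<open>K[x,H]\<close> with
  basis \<open>1, y\<close>; write \<open>a = A + y B\<close>. As \<open>\<delta>(H) = 0\<close>, on \<open>K[x,H]\<close> the map \<open>\<delta>\<close> is \<open>y\<close>
  times \<open>D = \<partial>/\<partial>x\<close> (at constant \<open>H\<close>), and the equation splits into
  \<open>(H + 2F) D\<^sup>2A + f DA - f' A = 0\<close> and \<open>(H + 2F) D\<^sup>2B + 3 f DB = 0\<close>.
  Compare coefficients of powers of \<open>H\<close>. If \<open>m\<close> is the degree of a coefficient in \<open>x\<close> and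
  \<open>N = deg f + 1\<close>, the leading coefficient of \<open>2F c'' + f c' - f' c\<close> vanishes only for
  \<open>2m = N\<close>. The top coefficient of \<open>A\<close> has degree at most \<open>1 < N/2\<close>, and each step
  down raises the degree by \<open>N\<close>, so the recursion never terminates unless \<open>A = 0\<close>. The second
  equation similarly forces \<open>DB = 0\<close>, that is \<open>B \<in> K[H]\<close>. So \<open>\<gamma>(x) = B y\<close> and \<open>\<gamma>(y) = B f\<close>.
\<close>

section \<open>Degree bounds for products and derivatives\<close>

lemma coeff_mult_degree_le:
  fixes p q :: "'a::comm_semiring_0 poly"
  assumes "degree p \<le> i" "degree q \<le> j"
  shows "coeff (p * q) (i + j) = coeff p i * coeff q j"
proof -
  have "coeff p k * coeff q (i + j - k) = (if k = i then coeff p i * coeff q j else 0)"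
    if "k \<le> i + j" for k
    using assms that by (cases k i rule: linorder_cases) (auto simp: coeff_eq_0)
  then show ?thesis by (simp add: coeff_mult)
qed

lemma numeral_mult_poly:
  fixes p :: "'a::comm_ring_1 poly"
  shows "numeral k * p = smult (numeral k) p" "p * numeral k = smult (numeral k) p"
  by (simp_all add: numeral_poly)

text \<open>The factor x restores the degree lost in differentiation, so the operator is diagonal on
  monomials and constants need no separate case.\<close>

lemma coeff_x_pderiv: "coeff (pCons 0 (pderiv p)) j = of_nat j * coeff p j"
  by (cases j) (simp_all add: coeff_pderiv)

lemma coeff_x2_pderiv2:
  fixes p :: "'a::idom poly"
  shows "coeff (pCons 0 (pCons 0 (pderiv (pderiv p)))) j = of_nat j * (of_nat j - 1) * coeff p j"
  by (cases j; cases "j - 1") (auto simp: coeff_pderiv algebra_simps)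

lemma degree_x_pderiv_le: "degree (pCons 0 (pderiv p)) \<le> degree p"
  by (rule degree_le) (simp add: coeff_x_pderiv coeff_eq_0 del: coeff_pCons)

lemma degree_x2_pderiv2_le:
  fixes p :: "'a::idom poly"
  shows "degree (pCons 0 (pCons 0 (pderiv (pderiv p)))) \<le> degree p"
  by (rule degree_le) (simp add: coeff_x2_pderiv2 coeff_eq_0 del: coeff_pCons)

lemma degree_antideriv_le: "degree (antideriv f) \<le> Suc (degree f)"
  by (rule degree_le) (auto simp: coeff_antideriv coeff_eq_0 split: nat.split)

subsection \<open>Leading coefficients of the two differential operators\<close>

text \<open>If A has coefficients c_i in H, the coefficient of H^(i+1) in the equation for A is
  c_i'' + \<open>even_op f\<close> c_(i+1).\<close>

definition even_op :: "'a::field_char_0 poly \<Rightarrow> 'a poly \<Rightarrow> 'a poly" where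
  "even_op f c = 2 * antideriv f * pderiv (pderiv c) + f * pderiv c - pderiv f * c"

text \<open>With n = deg f and m = deg c, the three terms contribute 2m(m-1) + (n+1)m - n(n+1) =
  (2m-n-1)(m+n). The factor n+1 on the left clears the denominator from the antiderivative.\<close>

lemma even_op_shift:
  fixes f c :: "'a::field_char_0 poly"
  defines "r \<equiv> pCons 0 (pCons 0 (even_op f c))"
  shows "of_nat (Suc (degree f)) * coeff r (Suc (degree f) + degree c) =
      (2 * of_nat (degree c) - of_nat (Suc (degree f))) * of_nat (degree c + degree f) *
      lead_coeff f * lead_coeff c"
    and "degree r \<le> Suc (degree f) + degree c"
proof -
  let ?n = "degree f" and ?m = "degree c"
  let ?c2 = "pCons 0 (pCons 0 (pderiv (pderiv c)))" and ?c1 = "pCons 0 (pderiv c)"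
  have r: "r = smult 2 (antideriv f * ?c2) + pCons 0 f * ?c1 - pCons 0 (pderiv f) * pCons 0 c"
    unfolding r_def even_op_def by (simp add: algebra_simps numeral_mult_poly)
  have t1: "coeff (antideriv f * ?c2) (Suc ?n + ?m)
      = lead_coeff f / of_nat (Suc ?n) * (of_nat ?m * (of_nat ?m - 1) * lead_coeff c)"
    unfolding coeff_mult_degree_le[OF degree_antideriv_le degree_x2_pderiv2_le] coeff_x2_pderiv2
    by (simp add: coeff_antideriv)
  have t2: "coeff (pCons 0 f * ?c1) (Suc ?n + ?m) = lead_coeff f * (of_nat ?m * lead_coeff c)"
    unfolding coeff_mult_degree_le[OF degree_pCons_le degree_x_pderiv_le] coeff_x_pderiv by simp
  have t3: "coeff (pCons 0 (pderiv f) * pCons 0 c) (Suc ?n + ?m)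
      = of_nat ?n * lead_coeff f * lead_coeff c"
    unfolding add_Suc_shift coeff_mult_degree_le[OF degree_x_pderiv_le degree_pCons_le] coeff_x_pderiv
    by simp
  have N: "of_nat (Suc ?n) \<noteq> (0::'a)" by (simp del: of_nat_Suc)
  show "of_nat (Suc ?n) * coeff r (Suc ?n + ?m) =
      (2 * of_nat ?m - of_nat (Suc ?n)) * of_nat (?m + ?n) * lead_coeff f * lead_coeff c"
    unfolding r coeff_add coeff_diff coeff_smult t1 t2 t3
    using N by (simp add: field_simps)
  have "degree (antideriv f * ?c2) \<le> Suc ?n + ?m"
    using degree_mult_le[of "antideriv f" ?c2] degree_antideriv_le[of f] degree_x2_pderiv2_le[of c]
    by linarith
  moreover have "degree (pCons 0 f * ?c1) \<le> Suc ?n + ?m"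
    using degree_mult_le[of "pCons 0 f" ?c1] degree_pCons_le[of 0 f] degree_x_pderiv_le[of c]
    by linarith
  moreover have "degree (pCons 0 (pderiv f) * pCons 0 c) \<le> Suc ?n + ?m"
    using degree_mult_le[of "pCons 0 (pderiv f)" "pCons 0 c"] degree_x_pderiv_le[of f]
      degree_pCons_le[of 0 c] by linarith
  ultimately show "degree r \<le> Suc ?n + ?m"
    unfolding r by (intro degree_diff_le degree_add_le order.trans[OF degree_smult_le])
qed

lemma even_op_degree:
  fixes f c :: "'a::field_char_0 poly"
  assumes "degree f > 0" "c \<noteq> 0" "2 * degree c \<noteq> Suc (degree f)"
  shows "even_op f c \<noteq> 0"
    and "degree (pCons 0 (pCons 0 (even_op f c))) = Suc (degree f) + degree c"
proof -
  have "of_nat (2 * degree c) \<noteq> (of_nat (Suc (degree f)) :: 'a)"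
    using assms(3) by (simp only: of_nat_eq_iff not_False_eq_True)
  then have "2 * of_nat (degree c) - of_nat (Suc (degree f)) \<noteq> (0::'a)" by simp
  moreover have "of_nat (degree c + degree f) \<noteq> (0::'a)"
    using assms(1) by (simp only: of_nat_eq_0_iff)
  moreover have "f \<noteq> 0" using assms(1) by auto
  ultimately have coeff: "coeff (pCons 0 (pCons 0 (even_op f c))) (Suc (degree f) + degree c) \<noteq> 0"
    using even_op_shift(1)[of f c] assms(2) by (metis leading_coeff_0_iff mult_eq_0_iff)
  then show "degree (pCons 0 (pCons 0 (even_op f c))) = Suc (degree f) + degree c"
    by (intro antisym even_op_shift(2) le_degree)
  show "even_op f c \<noteq> 0" using coeff by auto
qed

text \<open>Since x^2 e'' has degree deg f + 1 + deg c, deg e is at least deg f + 1 and cannot be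
  half of it.\<close>

lemma even_op_step:
  fixes f c e :: "'a::field_char_0 poly"
  assumes "degree f > 0" "c \<noteq> 0" "2 * degree c \<noteq> Suc (degree f)"
    and "pderiv (pderiv e) + even_op f c = 0"
  shows "e \<noteq> 0 \<and> 2 * degree e \<noteq> Suc (degree f)"
proof -
  let ?N = "Suc (degree f) + degree c"
  let ?e2 = "pCons 0 (pCons 0 (pderiv (pderiv e)))"
  have "?e2 = - pCons 0 (pCons 0 (even_op f c))"
    using assms(4) by (simp add: eq_neg_iff_add_eq_0)
  then have "degree ?e2 = ?N" using even_op_degree(2)[OF assms(1-3)] by (simp only: degree_minus)
  then have "?N \<le> degree e" using degree_x2_pderiv2_le[of e] by simp
  then show ?thesis by auto
qed

definition odd_op :: "'a::field_char_0 poly \<Rightarrow> 'a poly \<Rightarrow> 'a poly" where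
  "odd_op f u = 2 * antideriv f * pderiv u + 3 * f * u"

text \<open>The leading term carries the factor 2 deg u + 3 (deg f + 1), positive and hence nonzero
  in characteristic 0.\<close>

lemma odd_op_eq_0D:
  fixes f u :: "'a::field_char_0 poly"
  assumes "f \<noteq> 0" "odd_op f u = 0"
  shows "u = 0"
proof (rule ccontr)
  assume "u \<noteq> 0"
  let ?n = "degree f" and ?m = "degree u" and ?u1 = "pCons 0 (pderiv u)"
  have r: "pCons 0 (odd_op f u) = smult 2 (antideriv f * ?u1) + smult 3 (pCons 0 f * u)"
    unfolding odd_op_def by (simp add: algebra_simps numeral_mult_poly)
  have t1: "coeff (antideriv f * ?u1) (Suc ?n + ?m)
      = lead_coeff f / of_nat (Suc ?n) * (of_nat ?m * lead_coeff u)"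
    unfolding coeff_mult_degree_le[OF degree_antideriv_le degree_x_pderiv_le] coeff_x_pderiv
    by (simp add: coeff_antideriv)
  have t2: "coeff (pCons 0 f * u) (Suc ?n + ?m) = lead_coeff f * lead_coeff u"
    unfolding coeff_mult_degree_le[OF degree_pCons_le order.refl] by simp
  have N: "of_nat (Suc ?n) \<noteq> (0::'a)" by (simp del: of_nat_Suc)
  have "0 = of_nat (Suc ?n) * coeff (pCons 0 (odd_op f u)) (Suc ?n + ?m)"
    using assms(2) by simp
  also have "\<dots> = of_nat (2 * ?m + 3 * Suc ?n) * lead_coeff f * lead_coeff u"
    unfolding r coeff_add coeff_smult t1 t2 using N by (simp add: field_simps)
  finally have "of_nat (2 * ?m + 3 * Suc ?n) = (0::'a)"
    using assms(1) \<open>u \<noteq> 0\<close> by (metis leading_coeff_0_iff mult_eq_0_iff)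
  then show False by (simp only: of_nat_eq_0_iff) simp
qed

subsection \<open>Polynomials in \<open>x\<close> and \<open>H\<close>\<close>

text \<open>
  Below, the type \<open>'a poly poly\<close> also represents \<open>K[x][H]\<close>: composing with \<^term>\<open>H_poly f\<close>
  embeds it into \<open>K[x,y]\<close>, and \<^term>\<open>map_poly pderiv\<close> is the partial derivative in \<open>x\<close> at
  constant \<open>H\<close>.
\<close>

lemma H_poly_eq: "H_poly f = [:- (2 * antideriv f), 0, 1:]"
  by (simp add: H_poly_def varY_def power2_eq_square numeral_poly)

lemma varY_squared: "varY * varY = [:2 * antideriv f, 1:] \<circ>\<^sub>p H_poly f"
  by (simp add: H_poly_eq varY_def pcompose_pCons)

text \<open>Multiplication by y exchanges the two parts: y (A + y B) = (H + 2F) B + y A.\<close>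

lemma H_decomposition:
  fixes f :: "'a::field_char_0 poly"
  shows "\<exists>A B. a = A \<circ>\<^sub>p H_poly f + varY * (B \<circ>\<^sub>p H_poly f)"
proof (induction a)
  case 0
  have "0 = 0 \<circ>\<^sub>p H_poly f + varY * (0 \<circ>\<^sub>p H_poly f)" by simp
  then show ?case by blast
next
  case (pCons c p)
  then obtain A B where p: "p = A \<circ>\<^sub>p H_poly f + varY * (B \<circ>\<^sub>p H_poly f)" by blast
  have "pCons c p = [:c:] + varY * p" by (simp add: varY_def)
  also have "\<dots> = [:c:] \<circ>\<^sub>p H_poly f + varY * varY * (B \<circ>\<^sub>p H_poly f) + varY * (A \<circ>\<^sub>p H_poly f)"
    unfolding p by (simp add: algebra_simps)
  also have "\<dots> = ([:c:] + [:2 * antideriv f, 1:] * B) \<circ>\<^sub>p H_poly f + varY * (A \<circ>\<^sub>p H_poly f)"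
    unfolding varY_squared[of f] pcompose_add pcompose_mult ..
  finally show ?case by blast
qed

text \<open>H has degree 2 in y, so nonzero summands would have y-degrees of different parity and
  could not cancel.\<close>

lemma H_decomposition_unique:
  fixes f :: "'a::field_char_0 poly"
  assumes "A \<circ>\<^sub>p H_poly f + varY * (B \<circ>\<^sub>p H_poly f) = 0"
  shows "A = 0" and "B = 0"
proof -
  have H: "degree (H_poly f) = 2" by (simp add: H_poly_eq)
  show B: "B = 0"
  proof (rule ccontr)
    assume "B \<noteq> 0"
    then have "B \<circ>\<^sub>p H_poly f \<noteq> 0" using H by (metis pcompose_eq_0 zero_less_numeral)
    then have "degree (varY * (B \<circ>\<^sub>p H_poly f)) = Suc (2 * degree B)"
      by (simp add: varY_def degree_pcompose H)
    moreover have "degree (varY * (B \<circ>\<^sub>p H_poly f)) = 2 * degree A"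
      using assms by (metis H add_eq_0_iff degree_minus degree_pcompose mult.commute)
    ultimately show False by presburger
  qed
  then show "A = 0" using assms H pcompose_eq_0[of A "H_poly f"] by simp
qed

lemma pcompose_in_K_adjoin:
  fixes B :: "'a::field_char_0 poly poly"
  assumes "map_poly pderiv B = 0"
  shows "B \<circ>\<^sub>p h \<in> K_adjoin h"
  using assms
proof (induction B)
  case 0
  show ?case using K_subalgebra_K_adjoin[of h] unfolding K_subalgebra_def
    by (metis pCons_0_0 pcompose_0)
next
  case (pCons c B)
  have "pderiv c = 0" "map_poly pderiv B = 0"
    using pCons.prems by (simp_all add: map_poly_pCons)
  then obtain k where c: "c = [:k:]" by (metis pderiv_eq_0_iff degree_eq_zeroE)
  have "h \<in> K_adjoin h" unfolding K_adjoin_def by (simp add: hull_inc)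
  with pCons.IH[OF \<open>map_poly pderiv B = 0\<close>] show ?case
    using K_subalgebra_K_adjoin[of h] unfolding c pcompose_pCons K_subalgebra_def by simp
qed

section \<open>Solving the two equations over K[x][H]\<close>

lemma even_equation_trivial:
  fixes f :: "'a::field_char_0 poly"
  assumes "degree f \<ge> 2"
    and eq: "[:2 * antideriv f, 1:] * map_poly pderiv (map_poly pderiv A) + [:f:] * map_poly pderiv A
      - [:pderiv f:] * A = 0"
  shows "A = 0"
proof (rule ccontr)
  assume "A \<noteq> 0"
  let ?c = "coeff A"
  have c: "coeff ([:2 * antideriv f, 1:] * map_poly pderiv (map_poly pderiv A) +
      [:f:] * map_poly pderiv A - [:pderiv f:] * A) j = 0" for j
    unfolding eq by simp
  have zero: "even_op f (?c 0) = 0"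
    using c[of 0] by (simp add: even_op_def coeff_map_poly)
  have step: "pderiv (pderiv (?c i)) + even_op f (?c (Suc i)) = 0" for i
    using c[of "Suc i"] by (simp add: even_op_def coeff_map_poly algebra_simps)
  have "?c (degree A - k) \<noteq> 0 \<and> 2 * degree (?c (degree A - k)) \<noteq> Suc (degree f)"
    if "k \<le> degree A" for k
    using that
  proof (induction k)
    case 0
    \<comment> \<open>The coefficient above the top one is 0, so the recursion loses its
      \<open>even_op\<close> term.\<close>
    have "pderiv (pderiv (lead_coeff A)) = 0"
      using step[of "degree A"] by (simp add: coeff_eq_0 even_op_def)
    then have "degree (lead_coeff A) \<le> 1"
      by (metis One_nat_def degree_pderiv diff_is_0_eq pderiv_eq_0_iff)
    with \<open>A \<noteq> 0\<close> assms(1) show ?case by simp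
  next
    case (Suc k)
    have "Suc (degree A - Suc k) = degree A - k" using Suc.prems by simp
    with step[of "degree A - Suc k"]
    have "pderiv (pderiv (?c (degree A - Suc k))) + even_op f (?c (degree A - k)) = 0" by metis
    then show ?case using even_op_step Suc assms(1) by (metis Suc_leD not_numeral_le_zero not_gr_zero)
  qed
  \<comment> \<open>At the bottom no lower coefficient remains to cancel
    \<open>even_op f (?c 0)\<close>.\<close>
  from this[of "degree A"] have "?c 0 \<noteq> 0" "2 * degree (?c 0) \<noteq> Suc (degree f)" by auto
  then show False using even_op_degree(1)[of f "?c 0"] zero assms(1) by simp
qed

text \<open>Here the induction runs upwards: \<open>odd_op f\<close> has trivial kernel, so each
  vanishing coefficient forces the next to vanish.\<close>

lemma odd_equation_trivial:
  fixes f :: "'a::field_char_0 poly"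
  assumes "f \<noteq> 0"
    and eq: "[:2 * antideriv f, 1:] * map_poly pderiv U + [:3 * f:] * U = 0"
  shows "U = 0"
proof (rule poly_eqI)
  fix i
  have c: "coeff ([:2 * antideriv f, 1:] * map_poly pderiv U + [:3 * f:] * U) j = 0" for j
    unfolding eq by simp
  have "odd_op f (coeff U 0) = 0"
    using c[of 0] by (simp add: odd_op_def coeff_map_poly)
  moreover have "odd_op f (coeff U (Suc j)) = - pderiv (coeff U j)" for j
    using c[of "Suc j"] by (simp add: odd_op_def coeff_map_poly eq_neg_iff_add_eq_0 algebra_simps)
  ultimately have "coeff U i = 0"
    by (induction i) (auto intro: odd_op_eq_0D[OF assms(1)])
  then show "coeff U i = coeff 0 i" by simp
qed

section \<open>Derivations in the coordinates x and H\<close>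

lemma K_derivation_eq:
  fixes d :: "'a::idom poly poly \<Rightarrow> 'a poly poly"
  assumes "K_derivation d"
  shows "d p = d varX * map_poly pderiv p + d varY * pderiv p"
proof -
  let ?e = "\<lambda>p. d varX * map_poly pderiv p + d varY * pderiv p"
  have "K_derivation ?e"
    unfolding K_derivation_def
    by (simp add: map_poly_pderiv_add map_poly_pderiv_mult pderiv_add pderiv_mult
        map_poly_pCons pderiv_pCons algebra_simps)
  moreover have "?e varX = d varX" "?e varY = d varY"
    by (simp_all add: varX_def varY_def map_poly_pCons pderiv_pCons map_poly_1 flip: one_pCons)
  ultimately have "d = ?e" using K_derivation_ex1[of "d varX" "d varY"] assms by blast
  then show ?thesis by metis
qed

text \<open>Chain rule, using \<delta>(H) = 2yf - 2fy = 0.\<close>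

lemma derivation_pcompose_H:
  fixes f :: "'a::field_char_0 poly"
  assumes "K_derivation \<delta>" "\<delta> varX = varY" "\<delta> varY = [:f:]"
  shows "\<delta> (A \<circ>\<^sub>p H_poly f) = varY * (map_poly pderiv A \<circ>\<^sub>p H_poly f)"
proof (induction A)
  case 0
  show ?case using K_derivation_eq[OF assms(1), of 0] by simp
next
  case (pCons c A)
  note eq = K_derivation_eq[OF assms(1), unfolded assms(2,3)]
  have "\<delta> (H_poly f) = 0"
    by (simp add: eq H_poly_eq map_poly_pCons pderiv_pCons pderiv_minus pderiv_smult
        pderiv_antideriv varY_def numeral_mult_poly)
  moreover have "\<delta> [:c:] = varY * [:pderiv c:]"
    by (simp add: eq map_poly_pCons pderiv_pCons)
  moreover have "\<delta> ([:c:] + H_poly f * (A \<circ>\<^sub>p H_poly f)) =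
      \<delta> [:c:] + \<delta> (H_poly f) * (A \<circ>\<^sub>p H_poly f) + H_poly f * \<delta> (A \<circ>\<^sub>p H_poly f)"
    using assms(1) by (simp add: K_derivation_def)
  ultimately show ?case
    using pCons.IH by (simp add: pcompose_pCons map_poly_pCons algebra_simps)
qed

lemma derivation_varY_pcompose_H:
  fixes f :: "'a::field_char_0 poly"
  assumes "K_derivation \<delta>" "\<delta> varX = varY" "\<delta> varY = [:f:]"
  shows "\<delta> (varY * (B \<circ>\<^sub>p H_poly f)) =
    ([:f:] * B + [:2 * antideriv f, 1:] * map_poly pderiv B) \<circ>\<^sub>p H_poly f"
proof -
  have "\<delta> (varY * (B \<circ>\<^sub>p H_poly f)) =
      [:f:] * (B \<circ>\<^sub>p H_poly f) + varY * varY * (map_poly pderiv B \<circ>\<^sub>p H_poly f)"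
    using assms(1,3) derivation_pcompose_H[OF assms] by (simp add: K_derivation_def mult.assoc)
  then show ?thesis unfolding varY_squared[of f] pcompose_add pcompose_mult by simp
qed

lemma second_order_solution:
  fixes f :: "'a::field_char_0 poly"
  assumes deg: "degree f \<ge> 2"
    and \<delta>: "K_derivation \<delta>" "\<delta> varX = varY" "\<delta> varY = [:f:]"
    and sol: "\<delta> (\<delta> a) = [:pderiv f:] * a"
  shows "\<exists>B. map_poly pderiv B = 0 \<and> a = varY * (B \<circ>\<^sub>p H_poly f)"
proof -
  let ?D = "map_poly pderiv" and ?P = "[:2 * antideriv f, 1:]"
  obtain A B where a: "a = A \<circ>\<^sub>p H_poly f + varY * (B \<circ>\<^sub>p H_poly f)"
    using H_decomposition by blast
  have add: "\<delta> (p + q) = \<delta> p + \<delta> q" for p q using \<delta>(1) by (simp add: K_derivation_def)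
  let ?U = "[:f:] * ?D A + ?P * ?D (?D A)" and ?V = "?D ([:f:] * B + ?P * ?D B)"
  have "(?U - [:pderiv f:] * A) \<circ>\<^sub>p H_poly f + varY * ((?V - [:pderiv f:] * B) \<circ>\<^sub>p H_poly f)
      = \<delta> (\<delta> a) - [:pderiv f:] * a"
    unfolding a add derivation_pcompose_H[OF \<delta>] derivation_varY_pcompose_H[OF \<delta>]
    by (simp only: pcompose_diff pcompose_mult[of "[:pderiv f:]"] pcompose_const)
       (simp add: algebra_simps del: mult_pCons_left)
  also have "\<dots> = 0" using sol by simp
  finally have "(?U - [:pderiv f:] * A) \<circ>\<^sub>p H_poly f
      + varY * ((?V - [:pderiv f:] * B) \<circ>\<^sub>p H_poly f) = 0" .
  note U = H_decomposition_unique(1)[OF this] and V = H_decomposition_unique(2)[OF this]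
  have "A = 0"
    by (rule even_equation_trivial[OF deg]) (use U in \<open>simp only: add.commute\<close>)
  have D: "?D ?P = [:2 * f:]" "?D [:f:] = [:pderiv f:]"
    by (simp_all add: map_poly_pCons pderiv_smult pderiv_antideriv numeral_mult_poly)
  \<comment> \<open>One f comes from \<delta>(y), the other 2f from differentiating H + 2F in x. The
    terms f' B cancel, leaving an equation in \<open>?D B\<close> alone.\<close>
  have f3: "[:3 * f:] = [:f:] + [:2 * f:]" by simp
  have "?P * ?D (?D B) + [:3 * f:] * ?D B = ?V - [:pderiv f:] * B"
    unfolding map_poly_pderiv_add map_poly_pderiv_mult D f3
    by (simp only: algebra_simps add_0_right diff_add_cancel)
  also have "\<dots> = 0" by (rule V)
  finally have "?D B = 0" using deg odd_equation_trivial[of f "?D B"] by force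
  with a \<open>A = 0\<close> show ?thesis by auto
qed

theorem theorem3p1:
  fixes f :: "'a::field_char_0 poly"
    and \<delta> \<gamma> :: "'a poly poly \<Rightarrow> 'a poly poly"
  assumes "degree f \<ge> 2"
    and "K_derivation \<delta>" and "\<delta> varX = varY" and "\<delta> varY = [:f:]"
    and "K_derivation \<gamma>"
    and "\<forall>a. \<gamma> (\<delta> a) = \<delta> (\<gamma> a)"
  shows "\<exists>q \<in> K_adjoin (H_poly f). \<gamma> = (\<lambda>a. q * \<delta> a)"
proof -
  note \<delta> = assms(2-4)
  have y: "\<gamma> varY = \<delta> (\<gamma> varX)" using assms(3,6) by metis
  have "\<delta> (\<delta> (\<gamma> varX)) = \<gamma> [:f:]" using y assms(4,6) by metis
  also have "\<dots> = [:pderiv f:] * \<gamma> varX"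
    by (simp add: K_derivation_eq[OF assms(5), of "[:f:]"] map_poly_pCons pderiv_pCons)
  finally obtain B where B: "map_poly pderiv B = 0" and x: "\<gamma> varX = varY * (B \<circ>\<^sub>p H_poly f)"
    using second_order_solution[OF assms(1) \<delta>] by blast
  have y: "\<gamma> varY = [:f:] * (B \<circ>\<^sub>p H_poly f)"
    unfolding y x derivation_varY_pcompose_H[OF \<delta>] B by (simp add: pcompose_smult)
  have "\<gamma> p = B \<circ>\<^sub>p H_poly f * \<delta> p" for p
    unfolding K_derivation_eq[OF assms(5), of p] K_derivation_eq[OF \<delta>(1), of p] x y \<delta>(2,3)
    by (simp add: algebra_simps)
  then show ?thesis using pcompose_in_K_adjoin[OF B, of "H_poly f"] by blast
qed

end
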